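(* Let $G$ be a group, $p$ a prime number, $q=p^n$, and let $\mathbb{F}_{q}^\alpha[G,\sigma]$ be a twisted skew group ring. Let $\lambda$ be a generator of the cyclic group $\mathbb{F}_q^*$ with minimal polynomial $P(x)\in\mathbb{F}_p[x]$ over $\mathbb{F}_p$. Then there is an epimorphism of $\mathbb{F}_p$-algebras $\psi:\mathbb{F}_p\hat{G}\longrightarrow \mathbb{F}_{q}^\alpha[G,\sigma]$ such that $\ker(\psi)=\langle P((\lambda,1))\rangle$, the two-sided ideal of $\mathbb{F}_p\hat G$ generated by $P((\lambda,1))$.
   Context: Here $\sigma:G\to \mathrm{Aut}(\mathbb{F}_q)$ is a group homomorphism, and we write $x^g={}^g x=\sigma(g)(x)$. The map $\alpha:G\times G\to\mathbb{F}_q^*$ is a normalized 2-cocycle: $\alpha(x,y)\alpha(xy,z)=\alpha(y,z)^x\,\alpha(x,yz)$ for all $x,y,z\in G$, and $\alpha(1,g)=\alpha(g,1)=1$ for all $g \in G$. The twisted skew group ring $\mathbb{F}_q^\alpha[G,\sigma]$ is the free $\mathbb{F}_q$-module with basis $\{\overline g: g\in G\}$ and multiplication $(a\overline{x})(b\overline{y})=a\,b^x\,\alpha(x,y)\,\overline{xy}$, extended additively; it is an associative $\mathbb{F}_p$-algebra. The group $\hat G$ is the set $\mathbb{F}_q^*\times G$ with operation $(a,g)(b,h)=(a\,b^g\,\alpha(g,h),gh)$, and $\mathbb{F}_p\hat G$ is its group algebra. If $P(x)=\sum_i c_i x^i$, then $P((\lambda,1))=\sum_i c_i(\lambda,1)^i\in\mathbb{F}_p\hat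 G$. *)

theory Defs
  imports
    "HOL-Computational_Algebra.Primes"
    "HOL-Algebra.Bij"
    "HOL-Algebra.Module"
    "HOL-Algebra.Finite_Extensions"
begin

text \<open>
  The group of ring automorphisms of \<open>R\<close>, built like \<^const>\<open>AutoGroup\<close>:
  its elements are extensional functions on \<open>carrier R\<close>, composed as functions.
\<close>

definition ring_AutoGroup :: "('a, 'm) ring_scheme \<Rightarrow> ('a \<Rightarrow> 'a) monoid"
  where "ring_AutoGroup R = BijGroup (carrier R) \<lparr>carrier := ring_iso R R \<inter> Bij (carrier R)\<rparr>"

definition normalized_2cocycle ::
    "('a, 'm) ring_scheme \<Rightarrow> ('g, 'n) monoid_scheme \<Rightarrow> ('g \<Rightarrow> 'a \<Rightarrow> 'a) \<Rightarrow> ('g \<Rightarrow> 'g \<Rightarrow> 'a) \<Rightarrow> bool"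
  where "normalized_2cocycle R G \<sigma> \<alpha> \<longleftrightarrow>
    (\<forall>x\<in>carrier G. \<forall>y\<in>carrier G. \<alpha> x y \<in> Units R) \<and>
    (\<forall>x\<in>carrier G. \<forall>y\<in>carrier G. \<forall>z\<in>carrier G.
       \<alpha> x y \<otimes>\<^bsub>R\<^esub> \<alpha> (x \<otimes>\<^bsub>G\<^esub> y) z = \<sigma> x (\<alpha> y z) \<otimes>\<^bsub>R\<^esub> \<alpha> x (y \<otimes>\<^bsub>G\<^esub> z)) \<and>
    (\<forall>g\<in>carrier G. \<alpha> \<one>\<^bsub>G\<^esub> g = \<one>\<^bsub>R\<^esub> \<and> \<alpha> g \<one>\<^bsub>G\<^esub> = \<one>\<^bsub>R\<^esub>)"

definition supp :: "('a, 'm) ring_scheme \<Rightarrow> ('g \<Rightarrow> 'a) \<Rightarrow> 'g set"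
  where "supp R f = {x. f x \<noteq> \<zero>\<^bsub>R\<^esub>}"

text \<open>
  The function that takes the value \<open>a\<close> at \<open>g\<close> and vanishes elsewhere stands for the element
  \<open>a\<close> times the basis vector of \<open>g\<close>.
\<close>

definition monomial :: "('a, 'm) ring_scheme \<Rightarrow> 'a \<Rightarrow> 'g \<Rightarrow> 'g \<Rightarrow> 'a"
  where "monomial R a g = (\<lambda>x. if x = g then a else \<zero>\<^bsub>R\<^esub>)"

text \<open>
  The twisted skew group ring.  An element is its coefficient function: finitely supported,
  and zero outside \<open>carrier G\<close> so that equality of functions is equality of elements.  The product
  is the biadditive extension of the rule for monomials, see \<open>monomial_mult\<close> below.
  Scalars act by left multiplication on the coefficients.
\<close>

definition twisted_skew_group_ring ::
    "('a, 'm) ring_scheme \<Rightarrow> ('g, 'n) monoid_scheme \<Rightarrow> ('g \<Rightarrow> 'a \<Rightarrow> 'a) \<Rightarrow> ('g \<Rightarrow> 'g \<Rightarrow> 'a)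
      \<Rightarrow> ('a, 'g \<Rightarrow> 'a) module"
  where "twisted_skew_group_ring R G \<sigma> \<alpha> =
    \<lparr>carrier = {f. range f \<subseteq> carrier R \<and> supp R f \<subseteq> carrier G \<and> finite (supp R f)},
     monoid.mult = \<lambda>f h z. finsum R (\<lambda>(x, y). f x \<otimes>\<^bsub>R\<^esub> \<sigma> x (h y) \<otimes>\<^bsub>R\<^esub> \<alpha> x y)
                      {(x, y) \<in> supp R f \<times> supp R h. x \<otimes>\<^bsub>G\<^esub> y = z},
     one = monomial R \<one>\<^bsub>R\<^esub> \<one>\<^bsub>G\<^esub>,
     zero = \<lambda>x. \<zero>\<^bsub>R\<^esub>,
     add = \<lambda>f h x. f x \<oplus>\<^bsub>R\<^esub> h x,
     smult = \<lambda>c f x. c \<otimes>\<^bsub>R\<^esub> f x\<rparr>"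

definition group_algebra ::
    "('a, 'm) ring_scheme \<Rightarrow> ('g, 'n) monoid_scheme \<Rightarrow> ('a, 'g \<Rightarrow> 'a) module"
  where "group_algebra K G = twisted_skew_group_ring K G (\<lambda>g a. a) (\<lambda>g h. \<one>\<^bsub>K\<^esub>)"

definition hat_group ::
    "('a, 'm) ring_scheme \<Rightarrow> ('g, 'n) monoid_scheme \<Rightarrow> ('g \<Rightarrow> 'a \<Rightarrow> 'a) \<Rightarrow> ('g \<Rightarrow> 'g \<Rightarrow> 'a)
      \<Rightarrow> ('a \<times> 'g) monoid"
  where "hat_group R G \<sigma> \<alpha> =
    \<lparr>carrier = Units R \<times> carrier G,
     monoid.mult = \<lambda>(a, g) (b, h). (a \<otimes>\<^bsub>R\<^esub> \<sigma> g b \<otimes>\<^bsub>R\<^esub> \<alpha> g h, g \<otimes>\<^bsub>G\<^esub> h),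
     one = (\<one>\<^bsub>R\<^esub>, \<one>\<^bsub>G\<^esub>)\<rparr>"

text \<open>
  The locale \<^locale>\<open>algebra\<close> requires a commutative algebra, hence the next two definitions.
\<close>

definition algebra_hom ::
    "('k, 'l) ring_scheme \<Rightarrow> ('k, 'a, 'm) module_scheme \<Rightarrow> ('k, 'b, 'n) module_scheme \<Rightarrow> ('a \<Rightarrow> 'b) set"
  where "algebra_hom K A B =
    {\<phi> \<in> ring_hom A B. \<forall>c\<in>carrier K. \<forall>x\<in>carrier A. \<phi> (c \<odot>\<^bsub>A\<^esub> x) = c \<odot>\<^bsub>B\<^esub> \<phi> x}"

definition algebra_epi ::
    "('k, 'l) ring_scheme \<Rightarrow> ('k, 'a, 'm) module_scheme \<Rightarrow> ('k, 'b, 'n) module_scheme \<Rightarrow> ('a \<Rightarrow> 'b) set"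
  where "algebra_epi K A B = {\<phi> \<in> algebra_hom K A B. \<phi> ` carrier A = carrier B}"

text \<open>
  Evaluation of a polynomial over \<open>K\<close> (a coefficient list, leading coefficient first) at an
  element of a \<open>K\<close>-algebra.
\<close>

definition algebra_eval ::
    "('k, 'l) ring_scheme \<Rightarrow> ('k, 'a, 'm) module_scheme \<Rightarrow> 'k list \<Rightarrow> 'a \<Rightarrow> 'a"
  where "algebra_eval K A P x =
    (\<Oplus>\<^bsub>A\<^esub>i\<in>{..degree P}. ring.coeff K P i \<odot>\<^bsub>A\<^esub> (x [^]\<^bsub>A\<^esub> i))"

lemma supp_monomial: "supp R (monomial R a g) = (if a = \<zero>\<^bsub>R\<^esub> then {} else {g})"
  by (auto simp: supp_def monomial_def)

lemma monomial_mult: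
  assumes "ring R" "a \<in> carrier R" "b \<in> carrier R" "\<alpha> x y \<in> carrier R"
    and "\<sigma> x \<in> ring_hom R R"
  shows "monomial R a x \<otimes>\<^bsub>twisted_skew_group_ring R G \<sigma> \<alpha>\<^esub> monomial R b y
    = monomial R (a \<otimes>\<^bsub>R\<^esub> \<sigma> x b \<otimes>\<^bsub>R\<^esub> \<alpha> x y) (x \<otimes>\<^bsub>G\<^esub> y)"
proof -
  interpret ring R by fact
  have s: "\<sigma> x b \<in> carrier R" "\<sigma> x \<zero>\<^bsub>R\<^esub> = \<zero>\<^bsub>R\<^esub>"
    using assms ring_hom_closed ring_hom_zero by fastforce+
  have v: "a \<otimes>\<^bsub>R\<^esub> \<sigma> x b \<otimes>\<^bsub>R\<^esub> \<alpha> x y \<in> carrier R"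
    using assms s by simp
  show ?thesis
  proof (cases "a = \<zero>\<^bsub>R\<^esub> \<or> b = \<zero>\<^bsub>R\<^esub>")
    case True
    then show ?thesis
      using assms s by (auto simp: twisted_skew_group_ring_def supp_def monomial_def fun_eq_iff)
  next
    case False
    have e: "{(x', y') \<in> supp R (monomial R a x) \<times> supp R (monomial R b y). x' \<otimes>\<^bsub>G\<^esub> y' = z}
        = (if x \<otimes>\<^bsub>G\<^esub> y = z then {(x, y)} else {})" for z
      using False by (auto simp: supp_monomial)
    have "(monomial R a x \<otimes>\<^bsub>twisted_skew_group_ring R G \<sigma> \<alpha>\<^esub> monomial R b y) z
        = monomial R (a \<otimes>\<^bsub>R\<^esub> \<sigma> x b \<otimes>\<^bsub>R\<^esub> \<alpha> x y) (x \<otimes>\<^bsub>G\<^esub> y) z" for z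
    proof (cases "x \<otimes>\<^bsub>G\<^esub> y = z")
      case True
      have "finsum R (\<lambda>(x', y'). monomial R a x x' \<otimes>\<^bsub>R\<^esub> \<sigma> x' (monomial R b y y') \<otimes>\<^bsub>R\<^esub> \<alpha> x' y') {(x, y)}
          = a \<otimes>\<^bsub>R\<^esub> \<sigma> x b \<otimes>\<^bsub>R\<^esub> \<alpha> x y"
        using v by (subst finsum_insert) (simp_all add: monomial_def)
      then show ?thesis
        unfolding twisted_skew_group_ring_def monoid.simps e using True by (simp add: monomial_def)
    next
      case False
      then show ?thesis
        unfolding twisted_skew_group_ring_def monoid.simps e by (auto simp: monomial_def)
    qed
    then show ?thesis by auto
  qed
qed

end

theory Submission
  imports Defs
begin

text \<open>
  Send the group element \<open>(a, g)\<close> of the extension group to \<open>a g\<close> in the twisted skew group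
  ring and extend linearly over the prime field; call this \<open>\<psi>\<close>. The group law of the extension
  group is the multiplication rule of the monomials \<open>a g\<close>, so \<open>\<psi>\<close> is multiplicative on group
  elements, and on their scalar multiples because ring automorphisms fix the prime field. It is
  onto because every nonzero monomial is the image of a group element.

  For the kernel, sort an element \<open>f\<close> of the group algebra by the second component of its group
  elements. Since \<open>(a, g) = (a, 1) (1, g)\<close> and every unit \<open>a\<close> is a power of \<open>lam\<close>, the part of
  \<open>f\<close> over \<open>g\<close> equals \<open>Q ((lam, 1)) (1, g)\<close> for a polynomial \<open>Q\<close> over the prime field
  (\<open>fibre_eq_lam_eval\<close>), and \<open>\<psi>\<close> maps it to \<open>Q (lam) g\<close>. Hence \<open>\<psi> f = 0\<close> forces \<open>Q (lam) = 0\<close>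
  for every \<open>g\<close>, the minimal polynomial \<open>P\<close> of \<open>lam\<close> divides \<open>Q\<close>, and the part over \<open>g\<close> lies in the
  ideal generated by \<open>P ((lam, 1))\<close> (\<open>kernel_subset_ideal\<close>). Conversely,
  \<open>\<psi> (P ((lam, 1))) = P (lam) 1 = 0\<close>.

  The group algebra is the twisted skew group ring of the extension group with trivial action and
  cocycle. Both rings are therefore covered by one proof of the ring axioms (\<open>S_ring\<close>), which
  by biadditivity comes down to the cocycle identity on monomials.
\<close>

section \<open>Evaluating polynomials\<close>

lemma (in ring) eval_eq_finsum_coeff:
  assumes "set p \<subseteq> carrier R" "a \<in> carrier R"
  shows "eval p a = (\<Oplus>i\<in>{..degree p}. coeff p i \<otimes> a [^] i)"
proof -
  have "eval p a = (\<Oplus>i\<in>{..<length p}. coeff p i \<otimes> a [^] i)"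
    using assms(1)
  proof (induction p)
    case (Cons b p)
    have "(\<Oplus>i\<in>{..<length p}. coeff (b # p) i \<otimes> a [^] i) = (\<Oplus>i\<in>{..<length p}. coeff p i \<otimes> a [^] i)"
      using Cons.prems assms(2) by (intro finsum_cong') (auto simp: coeff_in_carrier)
    moreover have "coeff (b # p) i \<otimes> a [^] i \<in> carrier R" for i
      using Cons.prems assms(2) by (auto simp: coeff_in_carrier)
    ultimately show ?case
      using Cons assms(2) by (simp add: lessThan_Suc)
  qed simp
  then show ?thesis
    by (cases p) (simp_all add: lessThan_Suc_atMost)
qed

text \<open>
  Evaluation in a noncommutative ring is multiplicative as soon as the coefficients of the right
  factor commute with the argument: the value of the right factor then commutes with the powers
  of the argument, which is all that collecting the terms of the product needs.
\<close>
lemma (in ring) eval_poly_mult_commuting: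
  assumes "set p \<subseteq> carrier R" "set q \<subseteq> carrier R" "a \<in> carrier R"
    and comm: "\<And>c. c \<in> set q \<Longrightarrow> c \<otimes> a = a \<otimes> c"
  shows "eval (poly_mult p q) a = eval p a \<otimes> eval q a"
proof -
  have ec: "eval q a \<in> carrier R" and ecomm: "eval q a \<otimes> a = a \<otimes> eval q a"
  proof -
    have "eval q a \<in> carrier R \<and> eval q a \<otimes> a = a \<otimes> eval q a"
      using assms(2) comm
    proof (induction q)
      case (Cons c q)
      have c: "c \<in> carrier R" "c \<otimes> a = a \<otimes> c" using Cons.prems by auto
      have "(c \<otimes> a [^] length q) \<otimes> a = a \<otimes> (c \<otimes> a [^] length q)"
        using c assms(3) by (metis m_assoc nat_pow_Suc nat_pow_Suc2 nat_pow_closed)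
      then show ?case
        using Cons c assms(3) by (simp add: l_distr r_distr)
    qed (use assms(3) in simp)
    then show "eval q a \<in> carrier R" "eval q a \<otimes> a = a \<otimes> eval q a" by auto
  qed
  have pow: "eval q a \<otimes> a [^] n = a [^] n \<otimes> eval q a" for n :: nat
    using ec ecomm assms(3)
    by (induction n) (simp_all, metis m_assoc nat_pow_closed)
  have scale: "eval (map ((\<otimes>) b) q @ replicate n \<zero>) a = b \<otimes> a [^] n \<otimes> eval q a"
    if b: "b \<in> carrier R" for n b
  proof -
    have "set (map ((\<otimes>) b) q) \<subseteq> carrier R" "set (replicate n \<zero>) \<subseteq> carrier R"
      using assms(2) b by auto
    moreover have "eval (map ((\<otimes>) b) q) a = b \<otimes> eval q a"
      using assms(2) b by (induction q) (auto simp: assms(3) eval_in_carrier m_assoc r_distr)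
    ultimately show ?thesis
      using eval_append[of "map ((\<otimes>) b) q" "replicate n \<zero>" a]
        eval_replicate[of "[]" a n] assms(3) b ec pow[of n] by (simp add: m_assoc)
  qed
  show ?thesis
    using assms(1)
  proof (induction p)
    case Nil
    then show ?case using ec by simp
  next
    case (Cons b p)
    have b: "b \<in> carrier R" "set p \<subseteq> carrier R" using Cons.prems by auto
    have "set (map ((\<otimes>) b) q @ replicate (length p) \<zero>) \<subseteq> carrier R"
      using b assms(2) by auto
    moreover have "set (poly_mult p q) \<subseteq> carrier R"
      using poly_mult_in_carrier b(2) assms(2) by blast
    ultimately have "eval (poly_mult (b # p) q) a
        = b \<otimes> a [^] length p \<otimes> eval q a \<oplus> eval p a \<otimes> eval q a"
      using eval_poly_add assms(3) scale b Cons.IH by (simp del: poly_add.simps)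
    then show ?case
      using b assms(3) ec by (simp add: l_distr eval_in_carrier)
  qed
qed

text \<open>
  Otherwise evaluation would be injective on polynomials, and the infinitely many powers of the
  indeterminate would have distinct values.
\<close>
lemma (in domain) algebraic_if_finite_carrier:
  assumes "subfield k R" "finite (carrier R)" "x \<in> carrier R"
  shows "(algebraic over k) x"
proof (rule ccontr)
  assume "\<not> ?thesis"
  then have inj: "inj_on (\<lambda>p. eval p x) (carrier (k[X]))"
    by (simp add: over_def transcendental_def)
  have mem: "monom \<one> n \<in> carrier (k[X])" for n
    using monom_is_polynomial[OF subfieldE(1)[OF assms(1)], of \<one> n] subringE(3)[OF subfieldE(1)[OF assms(1)]]
    by (simp add: univ_poly_carrier)
  have "inj (monom \<one>)"
    by (rule injI) (use replicate_eq_replicate in \<open>auto simp: monom_def\<close>)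
  then have "inj (\<lambda>n. eval (monom \<one> n) x)"
    using inj mem by (auto simp: inj_on_def)
  moreover have "range (\<lambda>n. eval (monom \<one> n) x) \<subseteq> carrier R"
    using assms(3) by (auto intro!: eval_in_carrier monom_in_carrier)
  ultimately show False
    using assms(2) by (meson finite_imageD finite_subset infinite_UNIV_nat)
qed

section \<open>The twisted skew group ring is a ring\<close>

text \<open>
  Arbitrary commutative coefficients are allowed so that the group algebra of the extension group
  over a subfield, with trivial action and trivial cocycle, is another instance.
\<close>
locale twisted_skew = cring R + G: group G
  for R :: "('a, 'm) ring_scheme" (structure) and G :: "('g, 'n) monoid_scheme" +
  fixes \<sigma> :: "'g \<Rightarrow> 'a \<Rightarrow> 'a" and \<alpha> :: "'g \<Rightarrow> 'g \<Rightarrow> 'a"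
  assumes \<sigma>_hom: "g \<in> carrier G \<Longrightarrow> \<sigma> g \<in> ring_hom R R"
    and \<sigma>_mult: "\<lbrakk>g \<in> carrier G; h \<in> carrier G; a \<in> carrier R\<rbrakk> \<Longrightarrow> \<sigma> (g \<otimes>\<^bsub>G\<^esub> h) a = \<sigma> g (\<sigma> h a)"
    and \<sigma>_one: "a \<in> carrier R \<Longrightarrow> \<sigma> \<one>\<^bsub>G\<^esub> a = a"
    and cocycle: "normalized_2cocycle R G \<sigma> \<alpha>"
begin

abbreviation S :: "('a, 'g \<Rightarrow> 'a) module"
  where "S \<equiv> twisted_skew_group_ring R G \<sigma> \<alpha>"

lemma \<sigma>_simps [simp]:
  assumes "g \<in> carrier G"
  shows "a \<in> carrier R \<Longrightarrow> \<sigma> g a \<in> carrier R"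
    and "\<sigma> g \<zero> = \<zero>" and "\<sigma> g \<one> = \<one>"
    and "\<lbrakk>a \<in> carrier R; b \<in> carrier R\<rbrakk> \<Longrightarrow> \<sigma> g (a \<oplus> b) = \<sigma> g a \<oplus> \<sigma> g b"
    and "\<lbrakk>a \<in> carrier R; b \<in> carrier R\<rbrakk> \<Longrightarrow> \<sigma> g (a \<otimes> b) = \<sigma> g a \<otimes> \<sigma> g b"
  using \<sigma>_hom[OF assms] ring_hom_zero ring_axioms
  by (auto simp: ring_hom_closed ring_hom_one ring_hom_add ring_hom_mult)

lemma \<sigma>_Units [simp]:
  assumes "g \<in> carrier G" "a \<in> Units R"
  shows "\<sigma> g a \<in> Units R"
proof -
  have "\<sigma> g (inv a) \<otimes> \<sigma> g a = \<one>" "\<sigma> g a \<otimes> \<sigma> g (inv a) = \<one>"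
    using assms by (metis \<sigma>_simps(3,5) Units_closed Units_inv_closed Units_l_inv,
        metis \<sigma>_simps(3,5) Units_closed Units_inv_closed Units_r_inv)
  moreover have "\<sigma> g (inv a) \<in> carrier R" "\<sigma> g a \<in> carrier R"
    using assms Units_closed by simp_all
  ultimately show ?thesis
    unfolding Units_def[of R] by blast
qed

lemma cocycle_Units [simp]: "\<lbrakk>g \<in> carrier G; h \<in> carrier G\<rbrakk> \<Longrightarrow> \<alpha> g h \<in> Units R"
  and cocycle_assoc: "\<lbrakk>g \<in> carrier G; h \<in> carrier G; l \<in> carrier G\<rbrakk> \<Longrightarrow>
    \<alpha> g h \<otimes> \<alpha> (g \<otimes>\<^bsub>G\<^esub> h) l = \<sigma> g (\<alpha> h l) \<otimes> \<alpha> g (h \<otimes>\<^bsub>G\<^esub> l)"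
  and cocycle_one [simp]: "g \<in> carrier G \<Longrightarrow> \<alpha> \<one>\<^bsub>G\<^esub> g = \<one>" "g \<in> carrier G \<Longrightarrow> \<alpha> g \<one>\<^bsub>G\<^esub> = \<one>"
  using cocycle by (auto simp: normalized_2cocycle_def)

lemma cocycle_closed [simp]: "\<lbrakk>g \<in> carrier G; h \<in> carrier G\<rbrakk> \<Longrightarrow> \<alpha> g h \<in> carrier R"
  by (rule Units_closed) simp

lemma S_carrierI:
  assumes "\<And>g. f g \<in> carrier R" "supp R f \<subseteq> carrier G" "finite (supp R f)"
  shows "f \<in> carrier S"
  using assms by (auto simp: twisted_skew_group_ring_def)

lemma S_carrierD:
  assumes "f \<in> carrier S"
  shows "f g \<in> carrier R" "supp R f \<subseteq> carrier G" "finite (supp R f)" "g \<notin> carrier G \<Longrightarrow> f g = \<zero>"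
  using assms by (auto simp: twisted_skew_group_ring_def supp_def)

lemma S_add [simp]: "f \<oplus>\<^bsub>S\<^esub> h = (\<lambda>g. f g \<oplus> h g)"
  and S_zero [simp]: "\<zero>\<^bsub>S\<^esub> = (\<lambda>g. \<zero>)"
  and S_one: "\<one>\<^bsub>S\<^esub> = monomial R \<one> \<one>\<^bsub>G\<^esub>"
  and S_smult: "c \<odot>\<^bsub>S\<^esub> f = (\<lambda>g. c \<otimes> f g)"
  by (simp_all add: twisted_skew_group_ring_def)

lemma monomial_closed [simp]:
  "\<lbrakk>a \<in> carrier R; g \<in> carrier G\<rbrakk> \<Longrightarrow> monomial R a g \<in> carrier S"
  by (rule S_carrierI) (auto simp: monomial_def supp_def)

lemma S_add_closed:
  assumes "f \<in> carrier S" "h \<in> carrier S"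
  shows "f \<oplus>\<^bsub>S\<^esub> h \<in> carrier S"
proof (rule S_carrierI)
  have "supp R (f \<oplus>\<^bsub>S\<^esub> h) \<subseteq> supp R f \<union> supp R h"
    by (auto simp: supp_def)
  then show "supp R (f \<oplus>\<^bsub>S\<^esub> h) \<subseteq> carrier G" "finite (supp R (f \<oplus>\<^bsub>S\<^esub> h))"
    using assms[THEN S_carrierD(2)] assms[THEN S_carrierD(3)] finite_subset by (blast, blast)
qed (use assms in \<open>simp add: S_carrierD\<close>)

lemma S_abelian_group: "abelian_group S"
proof (rule abelian_groupI)
  fix f assume f: "f \<in> carrier S"
  have m: "(\<lambda>g. \<ominus> f g) \<in> carrier S"
  proof (rule S_carrierI)
    have "supp R (\<lambda>g. \<ominus> f g) = supp R f"
      using f S_carrierD(1) by (auto simp: supp_def)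
    then show "supp R (\<lambda>g. \<ominus> f g) \<subseteq> carrier G" "finite (supp R (\<lambda>g. \<ominus> f g))"
      using S_carrierD[OF f] by simp_all
  qed (use f in \<open>simp add: S_carrierD\<close>)
  show "\<exists>y\<in>carrier S. y \<oplus>\<^bsub>S\<^esub> f = \<zero>\<^bsub>S\<^esub>"
    by (rule bexI[OF _ m]) (simp add: f S_carrierD l_neg)
next
  show "\<zero>\<^bsub>S\<^esub> \<in> carrier S"
    by (rule S_carrierI) (simp_all add: supp_def)
qed (simp_all add: S_carrierD S_add_closed[simplified] a_ac fun_eq_iff)

lemma restrict_closed:
  assumes "f \<in> carrier S"
  shows "(\<lambda>g. if g \<in> T then f g else \<zero>) \<in> carrier S"
proof (rule S_carrierI)
  have "supp R (\<lambda>g. if g \<in> T then f g else \<zero>) \<subseteq> supp R f"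
    by (auto simp: supp_def)
  then show "supp R (\<lambda>g. if g \<in> T then f g else \<zero>) \<subseteq> carrier G"
    "finite (supp R (\<lambda>g. if g \<in> T then f g else \<zero>))"
    using S_carrierD(2,3)[OF assms] finite_subset by blast+
qed (simp add: S_carrierD[OF assms])

text \<open>
  Biadditive identities only have to be checked on monomials. Zero needs no case of its own,
  being a monomial with coefficient zero.
\<close>
lemma S_induct [consumes 1, case_names monomial add]:
  assumes f: "f \<in> carrier S"
    and mono: "\<And>a g. \<lbrakk>a \<in> carrier R; g \<in> carrier G\<rbrakk> \<Longrightarrow> P (monomial R a g)"
    and add: "\<And>f h. \<lbrakk>f \<in> carrier S; h \<in> carrier S; P f; P h\<rbrakk> \<Longrightarrow> P (f \<oplus>\<^bsub>S\<^esub> h)"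
  shows "P f"
proof -
  have "P (\<lambda>g. if g \<in> T then f g else \<zero>)" if "finite T" "T \<subseteq> carrier G" for T
    using that
  proof (induction T)
    case empty
    have "(\<lambda>g::'g. \<zero>) = monomial R \<zero> \<one>\<^bsub>G\<^esub>"
      by (auto simp: monomial_def)
    then show ?case using mono[of \<zero> "\<one>\<^bsub>G\<^esub>"] by simp
  next
    case (insert t T)
    have "(\<lambda>g. if g \<in> insert t T then f g else \<zero>)
        = monomial R (f t) t \<oplus>\<^bsub>S\<^esub> (\<lambda>g. if g \<in> T then f g else \<zero>)"
      using insert.hyps S_carrierD(1)[OF f] by (auto simp: monomial_def)
    then show ?case
      using insert mono add f by (simp add: S_carrierD restrict_closed del: S_add)
  qed
  moreover have "(\<lambda>g. if g \<in> supp R f then f g else \<zero>) = f"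
    by (auto simp: supp_def)
  ultimately show ?thesis
    using S_carrierD(2,3)[OF f] by metis
qed

text \<open>
  Solving \<open>x y = z\<close> for \<open>y\<close> turns the sum over pairs into one over \<open>x\<close> alone. The index set
  may be any finite set containing the support, so two products can be summed over a common set,
  which makes the product biadditive.
\<close>
lemma S_mult_eq_finsum:
  assumes "f \<in> carrier S" "h \<in> carrier S" "finite T" "supp R f \<subseteq> T" "T \<subseteq> carrier G" "z \<in> carrier G"
  shows "(f \<otimes>\<^bsub>S\<^esub> h) z
    = (\<Oplus>x\<in>T. f x \<otimes> \<sigma> x (h (inv\<^bsub>G\<^esub> x \<otimes>\<^bsub>G\<^esub> z)) \<otimes> \<alpha> x (inv\<^bsub>G\<^esub> x \<otimes>\<^bsub>G\<^esub> z))"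
proof -
  let ?q = "\<lambda>x. inv\<^bsub>G\<^esub> x \<otimes>\<^bsub>G\<^esub> z"
  let ?t = "\<lambda>(x, y). f x \<otimes> \<sigma> x (h y) \<otimes> \<alpha> x y"
  let ?D = "{x \<in> supp R f. ?q x \<in> supp R h}"
  have x: "x \<in> carrier G" if "x \<in> supp R f" for x
    using that S_carrierD(2)[OF assms(1)] by auto
  have y: "y \<in> carrier G" if "y \<in> supp R h" for y
    using that S_carrierD(2)[OF assms(2)] by auto
  have D: "{(x, y) \<in> supp R f \<times> supp R h. x \<otimes>\<^bsub>G\<^esub> y = z} = (\<lambda>x. (x, ?q x)) ` ?D"
    using assms(6) x y by (auto simp: image_iff G.inv_solve_left' G.m_assoc[symmetric])
  have "(f \<otimes>\<^bsub>S\<^esub> h) z = finsum R ?t ((\<lambda>x. (x, ?q x)) ` ?D)"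
    unfolding D[symmetric] by (simp add: twisted_skew_group_ring_def)
  also have "\<dots> = (\<Oplus>x\<in>?D. ?t (x, ?q x))"
    using assms(6) x y S_carrierD(1)[OF assms(1)] S_carrierD(1)[OF assms(2)]
    by (intro finsum_reindex) (auto simp: inj_on_def)
  also have "\<dots> = (\<Oplus>x\<in>T. ?t (x, ?q x))"
  proof (rule add.finprod_mono_neutral_cong_left)
    show "?D \<subseteq> T" using assms(4) by auto
    show "(\<lambda>x. ?t (x, ?q x)) \<in> T \<rightarrow> carrier R"
      using assms(5,6) S_carrierD(1)[OF assms(1)] S_carrierD(1)[OF assms(2)] by (auto simp: subset_iff)
    show "?t (i, ?q i) = \<zero>" if "i \<in> T - ?D" for i
    proof -
      have "i \<in> carrier G" using that assms(5) by auto
      moreover have "f i = \<zero> \<or> h (?q i) = \<zero>" using that by (auto simp: supp_def)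
      ultimately show ?thesis
        using assms(6) S_carrierD(1)[OF assms(1)] S_carrierD(1)[OF assms(2)] by auto
    qed
  qed (use assms(3) in auto)
  finally show ?thesis by simp
qed

lemma S_mult_outside:
  assumes "f \<in> carrier S" "h \<in> carrier S" "z \<notin> carrier G"
  shows "(f \<otimes>\<^bsub>S\<^esub> h) z = \<zero>"
proof -
  have "{(x, y) \<in> supp R f \<times> supp R h. x \<otimes>\<^bsub>G\<^esub> y = z} = {}"
    using assms(3) S_carrierD(2)[OF assms(1)] S_carrierD(2)[OF assms(2)] by auto
  then show ?thesis
    unfolding twisted_skew_group_ring_def monoid.simps by (metis finsum_empty)
qed

lemma S_mult_closed:
  assumes "f \<in> carrier S" "h \<in> carrier S"
  shows "f \<otimes>\<^bsub>S\<^esub> h \<in> carrier S"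
proof (rule S_carrierI)
  fix z
  show "(f \<otimes>\<^bsub>S\<^esub> h) z \<in> carrier R"
  proof (cases "z \<in> carrier G")
    case True
    then show ?thesis
      using S_mult_eq_finsum[OF assms S_carrierD(3)[OF assms(1)] _ S_carrierD(2)[OF assms(1)] True]
        S_carrierD(1)[OF assms(1)] S_carrierD(1)[OF assms(2)] S_carrierD(2)[OF assms(1)]
      by (auto intro!: finsum_closed simp: subset_iff)
  qed (simp add: S_mult_outside assms)
next
  have "z \<in> (\<lambda>(x, y). x \<otimes>\<^bsub>G\<^esub> y) ` (supp R f \<times> supp R h)" if z: "z \<in> supp R (f \<otimes>\<^bsub>S\<^esub> h)" for z
  proof (rule ccontr)
    assume "\<not> ?thesis"
    then have "{(x, y) \<in> supp R f \<times> supp R h. x \<otimes>\<^bsub>G\<^esub> y = z} = {}" by auto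
    then have "(f \<otimes>\<^bsub>S\<^esub> h) z = \<zero>"
      unfolding twisted_skew_group_ring_def monoid.simps by (metis finsum_empty)
    then show False using z by (simp add: supp_def)
  qed
  then have "supp R (f \<otimes>\<^bsub>S\<^esub> h) \<subseteq> (\<lambda>(x, y). x \<otimes>\<^bsub>G\<^esub> y) ` (supp R f \<times> supp R h)" by blast
  then show "finite (supp R (f \<otimes>\<^bsub>S\<^esub> h))"
    using S_carrierD(3)[OF assms(1)] S_carrierD(3)[OF assms(2)] finite_subset by blast
  show "supp R (f \<otimes>\<^bsub>S\<^esub> h) \<subseteq> carrier G"
    using S_mult_outside[OF assms] by (auto simp: supp_def)
qed

lemma S_distrib:
  assumes "f \<in> carrier S" "h \<in> carrier S" "l \<in> carrier S"
  shows "(f \<oplus>\<^bsub>S\<^esub> h) \<otimes>\<^bsub>S\<^esub> l = f \<otimes>\<^bsub>S\<^esub> l \<oplus>\<^bsub>S\<^esub> h \<otimes>\<^bsub>S\<^esub> l"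
    and "l \<otimes>\<^bsub>S\<^esub> (f \<oplus>\<^bsub>S\<^esub> h) = l \<otimes>\<^bsub>S\<^esub> f \<oplus>\<^bsub>S\<^esub> l \<otimes>\<^bsub>S\<^esub> h"
proof -
  note [simp] = S_carrierD(1)[OF assms(1)] S_carrierD(1)[OF assms(2)] S_carrierD(1)[OF assms(3)]
  let ?T = "supp R f \<union> supp R h"
  have T: "finite ?T" "?T \<subseteq> carrier G"
    using assms[THEN S_carrierD(2)] assms[THEN S_carrierD(3)] by auto
  have sub: "supp R (f \<oplus>\<^bsub>S\<^esub> h) \<subseteq> ?T" by (auto simp: supp_def)
  have fh: "f \<oplus>\<^bsub>S\<^esub> h \<in> carrier S" by (rule S_add_closed[OF assms(1,2)])
  show "(f \<oplus>\<^bsub>S\<^esub> h) \<otimes>\<^bsub>S\<^esub> l = f \<otimes>\<^bsub>S\<^esub> l \<oplus>\<^bsub>S\<^esub> h \<otimes>\<^bsub>S\<^esub> l"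
  proof
    fix z
    show "((f \<oplus>\<^bsub>S\<^esub> h) \<otimes>\<^bsub>S\<^esub> l) z = (f \<otimes>\<^bsub>S\<^esub> l \<oplus>\<^bsub>S\<^esub> h \<otimes>\<^bsub>S\<^esub> l) z"
    proof (cases "z \<in> carrier G")
      case True
      let ?c = "\<lambda>f x. f x \<otimes> \<sigma> x (l (inv\<^bsub>G\<^esub> x \<otimes>\<^bsub>G\<^esub> z)) \<otimes> \<alpha> x (inv\<^bsub>G\<^esub> x \<otimes>\<^bsub>G\<^esub> z)"
      have "((f \<oplus>\<^bsub>S\<^esub> h) \<otimes>\<^bsub>S\<^esub> l) z = finsum R (?c (f \<oplus>\<^bsub>S\<^esub> h)) ?T"
        by (rule S_mult_eq_finsum[OF fh assms(3) T(1) sub T(2) True])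
      also have "\<dots> = finsum R (\<lambda>x. ?c f x \<oplus> ?c h x) ?T"
        using T(2) True by (intro finsum_cong') (auto simp: l_distr subset_iff)
      also have "\<dots> = finsum R (?c f) ?T \<oplus> finsum R (?c h) ?T"
        using T(2) True by (intro finsum_addf) (auto simp: subset_iff)
      also have "\<dots> = (f \<otimes>\<^bsub>S\<^esub> l \<oplus>\<^bsub>S\<^esub> h \<otimes>\<^bsub>S\<^esub> l) z"
        using S_mult_eq_finsum[OF assms(1,3) T(1) _ T(2) True]
          S_mult_eq_finsum[OF assms(2,3) T(1) _ T(2) True] by simp
      finally show ?thesis .
    qed (simp add: S_mult_outside assms fh[simplified])
  qed
  let ?U = "supp R l"
  have U: "finite ?U" "?U \<subseteq> carrier G" using S_carrierD[OF assms(3)] by auto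
  show "l \<otimes>\<^bsub>S\<^esub> (f \<oplus>\<^bsub>S\<^esub> h) = l \<otimes>\<^bsub>S\<^esub> f \<oplus>\<^bsub>S\<^esub> l \<otimes>\<^bsub>S\<^esub> h"
  proof
    fix z
    show "(l \<otimes>\<^bsub>S\<^esub> (f \<oplus>\<^bsub>S\<^esub> h)) z = (l \<otimes>\<^bsub>S\<^esub> f \<oplus>\<^bsub>S\<^esub> l \<otimes>\<^bsub>S\<^esub> h) z"
    proof (cases "z \<in> carrier G")
      case True
      let ?c = "\<lambda>f x. l x \<otimes> \<sigma> x (f (inv\<^bsub>G\<^esub> x \<otimes>\<^bsub>G\<^esub> z)) \<otimes> \<alpha> x (inv\<^bsub>G\<^esub> x \<otimes>\<^bsub>G\<^esub> z)"
      have "(l \<otimes>\<^bsub>S\<^esub> (f \<oplus>\<^bsub>S\<^esub> h)) z = finsum R (?c (f \<oplus>\<^bsub>S\<^esub> h)) ?U"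
        by (rule S_mult_eq_finsum[OF assms(3) fh U(1) order_refl U(2) True])
      also have "\<dots> = finsum R (\<lambda>x. ?c f x \<oplus> ?c h x) ?U"
        using U(2) True by (intro finsum_cong') (auto simp: l_distr r_distr subset_iff)
      also have "\<dots> = finsum R (?c f) ?U \<oplus> finsum R (?c h) ?U"
        using U(2) True by (intro finsum_addf) (auto simp: subset_iff)
      also have "\<dots> = (l \<otimes>\<^bsub>S\<^esub> f \<oplus>\<^bsub>S\<^esub> l \<otimes>\<^bsub>S\<^esub> h) z"
        using S_mult_eq_finsum[OF assms(3,1) U(1) order_refl U(2) True]
          S_mult_eq_finsum[OF assms(3,2) U(1) order_refl U(2) True] by simp
      finally show ?thesis .
    qed (simp add: S_mult_outside assms fh[simplified])
  qed
qed

lemma S_monomial_mult: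
  assumes "a \<in> carrier R" "b \<in> carrier R" "g \<in> carrier G" "h \<in> carrier G"
  shows "monomial R a g \<otimes>\<^bsub>S\<^esub> monomial R b h = monomial R (a \<otimes> \<sigma> g b \<otimes> \<alpha> g h) (g \<otimes>\<^bsub>G\<^esub> h)"
  using assms by (intro monomial_mult) (auto simp: ring_axioms \<sigma>_hom)

text \<open>
  This identity gives associativity both for monomials and, with units as coefficients, for the
  extension group.
\<close>
lemma twisted_mult_assoc:
  assumes "a \<in> carrier R" "b \<in> carrier R" "c \<in> carrier R"
    and "g \<in> carrier G" "h \<in> carrier G" "l \<in> carrier G"
  shows "a \<otimes> \<sigma> g b \<otimes> \<alpha> g h \<otimes> \<sigma> (g \<otimes>\<^bsub>G\<^esub> h) c \<otimes> \<alpha> (g \<otimes>\<^bsub>G\<^esub> h) l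
    = a \<otimes> \<sigma> g (b \<otimes> \<sigma> h c \<otimes> \<alpha> h l) \<otimes> \<alpha> g (h \<otimes>\<^bsub>G\<^esub> l)"
proof -
  have "a \<otimes> \<sigma> g b \<otimes> \<alpha> g h \<otimes> \<sigma> (g \<otimes>\<^bsub>G\<^esub> h) c \<otimes> \<alpha> (g \<otimes>\<^bsub>G\<^esub> h) l
      = a \<otimes> \<sigma> g b \<otimes> \<sigma> g (\<sigma> h c) \<otimes> (\<alpha> g h \<otimes> \<alpha> (g \<otimes>\<^bsub>G\<^esub> h) l)"
    using assms by (simp add: \<sigma>_mult m_ac)
  then show ?thesis
    using assms by (simp add: cocycle_assoc m_ac)
qed

lemma S_mult_assoc:
  assumes "f \<in> carrier S" "h \<in> carrier S" "l \<in> carrier S"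
  shows "f \<otimes>\<^bsub>S\<^esub> h \<otimes>\<^bsub>S\<^esub> l = f \<otimes>\<^bsub>S\<^esub> (h \<otimes>\<^bsub>S\<^esub> l)"
  using assms(1)
proof (induction rule: S_induct)
  case (monomial a x)
  note 1 = monomial
  from assms(2) show ?case
  proof (induction rule: S_induct)
    case (monomial b y)
    note 2 = monomial
    from assms(3) show ?case
    proof (induction rule: S_induct)
      case (monomial c z)
      then show ?case
        using 1 2 twisted_mult_assoc by (simp add: S_monomial_mult G.m_assoc)
    next
      case (add f h)
      then show ?case
        using 1 2 by (simp add: S_distrib S_mult_closed del: S_add)
    qed
  next
    case (add f h)
    then show ?case
      using 1 assms(3) by (simp add: S_distrib S_mult_closed del: S_add)
  qed
next
  case (add f h)
  then show ?case
    using assms(2,3) by (simp add: S_distrib S_mult_closed del: S_add)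
qed

lemma S_ring: "ring S"
proof (rule ringI[OF S_abelian_group])
  show "monoid S"
  proof (rule monoidI)
    show "\<one>\<^bsub>S\<^esub> \<in> carrier S" by (simp add: S_one)
    show "\<one>\<^bsub>S\<^esub> \<otimes>\<^bsub>S\<^esub> f = f" if "f \<in> carrier S" for f
      using that
    proof (induction rule: S_induct)
      case (monomial a g)
      then show ?case by (simp add: S_one S_monomial_mult \<sigma>_one)
    next
      case (add f h)
      then show ?case by (simp add: S_one S_distrib del: S_add)
    qed
    show "f \<otimes>\<^bsub>S\<^esub> \<one>\<^bsub>S\<^esub> = f" if "f \<in> carrier S" for f
      using that
    proof (induction rule: S_induct)
      case (monomial a g)
      then show ?case by (simp add: S_one S_monomial_mult)
    next
      case (add f h)
      then show ?case by (simp add: S_one S_distrib del: S_add)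
    qed
  qed (simp_all add: S_mult_closed S_mult_assoc)
qed (simp_all add: S_distrib del: S_add)

sublocale S: ring S by (rule S_ring)

lemma monomial_add: "\<lbrakk>a \<in> carrier R; b \<in> carrier R\<rbrakk> \<Longrightarrow>
    monomial R (a \<oplus> b) g = monomial R a g \<oplus>\<^bsub>S\<^esub> monomial R b g"
  by (auto simp: monomial_def)

lemma coefficient_embedding: "ring_hom_ring R S (\<lambda>a. monomial R a \<one>\<^bsub>G\<^esub>)"
  by (rule ring_hom_ringI)
    (simp_all add: ring_axioms S_ring S_monomial_mult \<sigma>_one monomial_add S_one del: S_add)

text \<open>
  It lets polynomials with scalar coefficients be evaluated inside the ring, where the coefficients
  are embedded through the basis element of the identity.
\<close>
lemma smult_eq_mult:
  assumes "c \<in> carrier R" "f \<in> carrier S"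
  shows "c \<odot>\<^bsub>S\<^esub> f = monomial R c \<one>\<^bsub>G\<^esub> \<otimes>\<^bsub>S\<^esub> f"
  using assms(2)
proof (induction rule: S_induct)
  case (monomial a g)
  moreover have "c \<odot>\<^bsub>S\<^esub> monomial R a g = monomial R (c \<otimes> a) g"
    using assms(1) by (auto simp: S_smult monomial_def)
  ultimately show ?case
    using assms(1) by (simp add: S_monomial_mult \<sigma>_one)
next
  case (add f h)
  have "c \<odot>\<^bsub>S\<^esub> (f \<oplus>\<^bsub>S\<^esub> h) = c \<odot>\<^bsub>S\<^esub> f \<oplus>\<^bsub>S\<^esub> c \<odot>\<^bsub>S\<^esub> h"
    using add.hyps assms(1) by (simp add: S_smult r_distr S_carrierD)
  then show ?case
    using add assms(1) by (simp only: S_distrib monomial_closed G.one_closed)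
qed

lemma group_hat_group: "group (hat_group R G \<sigma> \<alpha>)"
proof (rule groupI)
  fix x assume "x \<in> carrier (hat_group R G \<sigma> \<alpha>)"
  then obtain a g where x: "x = (a, g)" "a \<in> Units R" "g \<in> carrier G"
    by (auto simp: hat_group_def)
  let ?u = "\<sigma> (inv\<^bsub>G\<^esub> g) a \<otimes> \<alpha> (inv\<^bsub>G\<^esub> g) g"
  have "?u \<in> Units R" using x by simp
  then have "(inv ?u, inv\<^bsub>G\<^esub> g) \<otimes>\<^bsub>hat_group R G \<sigma> \<alpha>\<^esub> x = \<one>\<^bsub>hat_group R G \<sigma> \<alpha>\<^esub>"
    "(inv ?u, inv\<^bsub>G\<^esub> g) \<in> carrier (hat_group R G \<sigma> \<alpha>)"
    using x by (simp_all add: hat_group_def m_assoc Units_closed)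
  then show "\<exists>y\<in>carrier (hat_group R G \<sigma> \<alpha>). y \<otimes>\<^bsub>hat_group R G \<sigma> \<alpha>\<^esub> x = \<one>\<^bsub>hat_group R G \<sigma> \<alpha>\<^esub>"
    by blast
qed (auto simp: hat_group_def G.m_assoc twisted_mult_assoc \<sigma>_one Units_closed)

end

section \<open>The epimorphism from the group algebra of the extension group\<close>

text \<open>
  For a finite field with its prime field \<^term>\<open>k\<close>, pointwise invariance of \<^term>\<open>k\<close> is automatic;
  it is the property that makes \<open>\<psi>\<close> multiplicative.
\<close>

locale finite_field_twisted_skew = twisted_skew R G \<sigma> \<alpha> + field R
  for R :: "('a, 'm) ring_scheme" (structure) and G :: "('g, 'n) monoid_scheme" and \<sigma> \<alpha> +
  fixes k :: "'a set" and lam :: 'a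
  assumes k: "subfield k R" and finite: "finite (carrier R)"
    and \<sigma>_fixes: "\<lbrakk>g \<in> carrier G; c \<in> k\<rbrakk> \<Longrightarrow> \<sigma> g c = c"
    and lam: "lam \<in> Units R" and generates: "generate (units_of R) {lam} = Units R"
begin

abbreviation "K \<equiv> R\<lparr>carrier := k\<rparr>"
abbreviation "H \<equiv> hat_group R G \<sigma> \<alpha>"

lemma k_closed [simp]: "c \<in> k \<Longrightarrow> c \<in> carrier R"
  using subfieldE(3)[OF k] by auto

lemma k_simps [simp]:
  "\<zero> \<in> k" "\<one> \<in> k" "\<lbrakk>c \<in> k; d \<in> k\<rbrakk> \<Longrightarrow> c \<oplus> d \<in> k" "\<lbrakk>c \<in> k; d \<in> k\<rbrakk> \<Longrightarrow> c \<otimes> d \<in> k"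
  using subringE[OF subfieldE(1)[OF k]] by auto

lemma K_cring: "cring K"
  using subfield_iff(2)[OF k] by (rule fieldE(1))

sublocale A: twisted_skew K H "\<lambda>_ c. c" "\<lambda>_ _. \<one>"
  rewrites "twisted_skew_group_ring K H (\<lambda>_ c. c) (\<lambda>_ _. \<one>) = group_algebra K H"
proof -
  interpret K: cring K by (rule K_cring)
  have "normalized_2cocycle K H (\<lambda>_ c. c) (\<lambda>_ _. \<one>)"
    using K.Units_one_closed by (simp add: normalized_2cocycle_def)
  then show "twisted_skew K H (\<lambda>_ c. c) (\<lambda>_ _. \<one>)"
    by (intro twisted_skew.intro twisted_skew_axioms.intro K_cring group_hat_group)
      (simp_all add: ring_hom_def)
qed (simp add: group_algebra_def)

abbreviation "A \<equiv> group_algebra K H"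

lemma H_simps [simp]:
  "(a, g) \<in> carrier H \<longleftrightarrow> a \<in> Units R \<and> g \<in> carrier G"
  "(a, g) \<otimes>\<^bsub>H\<^esub> (b, h) = (a \<otimes> \<sigma> g b \<otimes> \<alpha> g h, g \<otimes>\<^bsub>G\<^esub> h)"
  "\<one>\<^bsub>H\<^esub> = (\<one>, \<one>\<^bsub>G\<^esub>)"
  by (simp_all add: hat_group_def)

lemma A_carrierD:
  assumes "f \<in> carrier A"
  shows "f z \<in> k" "f z \<in> carrier R" "g \<notin> carrier G \<Longrightarrow> f (a, g) = \<zero>"
  using A.S_carrierD(1)[OF assms, of z] A.S_carrierD(4)[OF assms, of "(a, g)"] by auto

text \<open>
  The linear extension of \<open>(a, g) \<mapsto> a g\<close>, written as a sum over the fibre of the projection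
  onto \<^term>\<open>G\<close>.
\<close>
definition \<psi> :: "('a \<times> 'g \<Rightarrow> 'a) \<Rightarrow> 'g \<Rightarrow> 'a"
  where "\<psi> f g = (\<Oplus>a\<in>Units R. f (a, g) \<otimes> a)"

lemma finite_Units: "finite (Units R)"
  using finite by (rule rev_finite_subset) auto

lemma \<psi>_add:
  assumes "f \<in> carrier A" "h \<in> carrier A"
  shows "\<psi> (f \<oplus>\<^bsub>A\<^esub> h) = \<psi> f \<oplus>\<^bsub>S\<^esub> \<psi> h"
proof
  fix g
  have "\<psi> (f \<oplus>\<^bsub>A\<^esub> h) g = (\<Oplus>a\<in>Units R. f (a, g) \<otimes> a \<oplus> h (a, g) \<otimes> a)"
    unfolding \<psi>_def using assms by (intro finsum_cong') (auto simp: A_carrierD l_distr)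
  also have "\<dots> = (\<psi> f \<oplus>\<^bsub>S\<^esub> \<psi> h) g"
    using assms by (simp add: \<psi>_def, subst finsum_addf) (auto simp: A_carrierD)
  finally show "\<psi> (f \<oplus>\<^bsub>A\<^esub> h) g = (\<psi> f \<oplus>\<^bsub>S\<^esub> \<psi> h) g" .
qed

lemma \<psi>_monomial:
  assumes "c \<in> k" "a \<in> Units R"
  shows "\<psi> (monomial K c (a, g)) = monomial R (c \<otimes> a) g"
proof
  fix h
  have "\<psi> (monomial K c (a, g)) h = (\<Oplus>b\<in>Units R. if a = b then (if h = g then c \<otimes> b else \<zero>) else \<zero>)"
    unfolding \<psi>_def using assms(1) by (intro finsum_cong') (auto simp: monomial_def)
  also have "\<dots> = monomial R (c \<otimes> a) g h"
    using assms finite_Units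
    by (subst add.finprod_singleton) (auto simp: monomial_def)
  finally show "\<psi> (monomial K c (a, g)) h = monomial R (c \<otimes> a) g h" .
qed

lemma \<psi>_closed: "f \<in> carrier A \<Longrightarrow> \<psi> f \<in> carrier S"
proof (induction rule: A.S_induct)
  case (monomial c z)
  then show ?case by (cases z) (simp add: \<psi>_monomial Units_closed)
next
  case (add f h)
  then show ?case by (simp only: \<psi>_add S.add.m_closed)
qed

text \<open>
  On monomials, moving the coefficient \<open>d\<close> of the second factor past \<open>x\<close> costs
  an application of \<open>\<sigma> x\<close> on the right-hand side but not on the left; this is where it matters
  that \<^term>\<open>k\<close> is fixed.
\<close>
lemma \<psi>_mult:
  assumes "f \<in> carrier A" "h \<in> carrier A"
  shows "\<psi> (f \<otimes>\<^bsub>A\<^esub> h) = \<psi> f \<otimes>\<^bsub>S\<^esub> \<psi> h"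
  using assms(1)
proof (induction rule: A.S_induct)
  case (monomial c z)
  obtain a x where z: "z = (a, x)" by (cases z)
  have 1: "c \<in> k" "a \<in> Units R" "x \<in> carrier G" using monomial z by auto
  from assms(2) show ?case
  proof (induction rule: A.S_induct)
    case (monomial d w)
    obtain b y where w: "w = (b, y)" by (cases w)
    have 2: "d \<in> k" "b \<in> Units R" "y \<in> carrier G" using monomial w by auto
    have "c \<otimes> d \<otimes> (a \<otimes> \<sigma> x b \<otimes> \<alpha> x y) = c \<otimes> a \<otimes> \<sigma> x (d \<otimes> b) \<otimes> \<alpha> x y"
      using 1 2 by (simp add: \<sigma>_fixes m_ac Units_closed)
    then show ?case
      using 1 2 by (simp add: z w A.S_monomial_mult \<psi>_monomial S_monomial_mult Units_closed)
  next
    case (add f h)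
    moreover have "monomial K c z \<in> carrier A" using 1 by (simp add: z)
    ultimately show ?case
      by (simp only: A.S_distrib S_distrib \<psi>_add \<psi>_closed A.S_mult_closed)
  qed
next
  case (add f h')
  then show ?case
    using assms(2) by (simp only: A.S_distrib S_distrib \<psi>_add \<psi>_closed A.S_mult_closed)
qed

lemma \<psi>_hom: "ring_hom_ring A S \<psi>"
proof (rule ring_hom_ringI)
  show "\<psi> \<one>\<^bsub>A\<^esub> = \<one>\<^bsub>S\<^esub>" by (simp add: A.S_one S_one \<psi>_monomial)
qed (simp_all only: A.S_ring S_ring \<psi>_closed \<psi>_mult \<psi>_add)

sublocale \<psi>: ring_hom_ring A S \<psi> by (rule \<psi>_hom)

lemma \<psi>_smult:
  assumes "c \<in> k" "f \<in> carrier A"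
  shows "\<psi> (c \<odot>\<^bsub>A\<^esub> f) = c \<odot>\<^bsub>S\<^esub> \<psi> f"
  using assms
  by (simp add: A.smult_eq_mult smult_eq_mult \<psi>_closed \<psi>_mult \<psi>_monomial)

lemma \<psi>_surj: "\<psi> ` carrier A = carrier S"
proof
  have "f \<in> \<psi> ` carrier A" if "f \<in> carrier S" for f
    using that
  proof (induction rule: S_induct)
    case (monomial a g)
    show ?case
    proof (cases "a = \<zero>")
      case True
      then have "monomial R a g = \<psi> (monomial K \<zero> (\<one>, g))"
        by (simp add: \<psi>_monomial)
      moreover have "monomial K \<zero> (\<one>, g) \<in> carrier A"
        using monomial by simp
      ultimately show ?thesis by (rule image_eqI)
    next
      case False
      then have a: "a \<in> Units R" using monomial field_Units by auto
      then have "monomial R a g = \<psi> (monomial K \<one> (a, g))"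
        by (simp add: \<psi>_monomial Units_closed)
      moreover have "monomial K \<one> (a, g) \<in> carrier A"
        using monomial a by simp
      ultimately show ?thesis by (rule image_eqI)
    qed
  next
    case (add f h)
    then obtain f' h' where "f' \<in> carrier A" "h' \<in> carrier A" "f = \<psi> f'" "h = \<psi> h'" by blast
    then have "f \<oplus>\<^bsub>S\<^esub> h = \<psi> (f' \<oplus>\<^bsub>A\<^esub> h')" "f' \<oplus>\<^bsub>A\<^esub> h' \<in> carrier A"
      by (simp_all only: \<psi>_add A.S_add_closed)
    then show ?case by (rule image_eqI)
  qed
  then show "carrier S \<subseteq> \<psi> ` carrier A" by blast
qed (use \<psi>_closed in blast)

section \<open>The kernel\<close>

text \<open>
  This is the same element as \<^const>\<open>algebra_eval\<close> at the group element of \<^term>\<open>lam\<close> (see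
  \<open>algebra_eval_eq_lam_eval\<close>), in a form to which the theory of polynomial evaluation applies.
\<close>

definition lam_eval :: "'a list \<Rightarrow> 'a \<times> 'g \<Rightarrow> 'a"
  where "lam_eval q = A.S.eval (map (\<lambda>c. monomial K c \<one>\<^bsub>H\<^esub>) q) (monomial K \<one> (lam, \<one>\<^bsub>G\<^esub>))"

sublocale \<iota>: ring_hom_ring K A "\<lambda>c. monomial K c \<one>\<^bsub>H\<^esub>"
  by (rule A.coefficient_embedding)

lemma lam_closed: "monomial K \<one> (lam, \<one>\<^bsub>G\<^esub>) \<in> carrier A"
  using lam by simp

lemma map_closed: "set q \<subseteq> k \<Longrightarrow> set (map (\<lambda>c. monomial K c \<one>\<^bsub>H\<^esub>) q) \<subseteq> carrier A"
  by auto

lemma lam_eval_closed: "set q \<subseteq> k \<Longrightarrow> lam_eval q \<in> carrier A"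
  unfolding lam_eval_def by (intro A.S.eval_in_carrier map_closed lam_closed)

lemma algebra_eval_eq_lam_eval:
  assumes "set q \<subseteq> k"
  shows "algebra_eval K A q (monomial K \<one> (lam, \<one>\<^bsub>G\<^esub>)) = lam_eval q"
proof -
  let ?x = "monomial K \<one> (lam, \<one>\<^bsub>G\<^esub>)"
  have "lam_eval q = (\<Oplus>\<^bsub>A\<^esub>i\<in>{..degree q}. monomial K (A.coeff q i) \<one>\<^bsub>H\<^esub> \<otimes>\<^bsub>A\<^esub> ?x [^]\<^bsub>A\<^esub> i)"
    using assms \<iota>.coeff_hom'[of q]
    by (simp only: lam_eval_def A.S.eval_eq_finsum_coeff map_closed lam_closed length_map) simp
  also have "\<dots> = (\<Oplus>\<^bsub>A\<^esub>i\<in>{..degree q}. A.coeff q i \<odot>\<^bsub>A\<^esub> ?x [^]\<^bsub>A\<^esub> i)"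
  proof (intro A.S.finsum_cong' funcsetI refl)
    fix i
    have c: "A.coeff q i \<in> carrier K" using assms by (intro A.coeff_in_carrier) simp
    have p: "?x [^]\<^bsub>A\<^esub> i \<in> carrier A" by (intro A.S.nat_pow_closed lam_closed)
    show "monomial K (A.coeff q i) \<one>\<^bsub>H\<^esub> \<otimes>\<^bsub>A\<^esub> ?x [^]\<^bsub>A\<^esub> i = A.coeff q i \<odot>\<^bsub>A\<^esub> ?x [^]\<^bsub>A\<^esub> i"
      by (rule A.smult_eq_mult[OF c p, symmetric])
    show "A.coeff q i \<odot>\<^bsub>A\<^esub> ?x [^]\<^bsub>A\<^esub> i \<in> carrier A"
      unfolding A.smult_eq_mult[OF c p] using c p by (intro A.S.m_closed \<iota>.hom_closed)
  qed
  finally show ?thesis by (simp add: algebra_eval_def)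
qed

lemma \<psi>_lam_eval:
  assumes "set q \<subseteq> k"
  shows "\<psi> (lam_eval q) = monomial R (eval q lam) \<one>\<^bsub>G\<^esub>"
proof -
  interpret j: ring_hom_ring R S "\<lambda>a. monomial R a \<one>\<^bsub>G\<^esub>"
    by (rule coefficient_embedding)
  have "map \<psi> (map (\<lambda>c. monomial K c \<one>\<^bsub>H\<^esub>) q) = map (\<lambda>a. monomial R a \<one>\<^bsub>G\<^esub>) q"
    using assms by (auto simp: \<psi>_monomial subset_iff)
  moreover have "\<psi> (monomial K \<one> (lam, \<one>\<^bsub>G\<^esub>)) = monomial R lam \<one>\<^bsub>G\<^esub>"
    using lam by (simp add: \<psi>_monomial Units_closed)
  moreover have "set q \<subseteq> carrier R" "lam \<in> carrier R" using assms lam by auto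
  ultimately show ?thesis
    unfolding lam_eval_def \<psi>.eval_hom'[OF lam_closed map_closed[OF assms]] by (simp only: j.eval_hom')
qed

lemma lam_eval_mult:
  assumes "set p \<subseteq> k" "set q \<subseteq> k"
  shows "lam_eval (poly_mult p q) = lam_eval p \<otimes>\<^bsub>A\<^esub> lam_eval q"
proof -
  let ?x = "monomial K \<one> (lam, \<one>\<^bsub>G\<^esub>)" and ?m = "map (\<lambda>c. monomial K c \<one>\<^bsub>H\<^esub>)"
  have pm: "poly_mult p q = A.poly_mult p q"
    using poly_mult_consistent[OF subfieldE(1)[OF k]] by metis
  have "set (A.poly_mult p q) \<subseteq> carrier K"
    using assms by (intro A.poly_mult_in_carrier) simp_all
  then have "lam_eval (poly_mult p q) = A.S.eval (A.S.normalize (?m (A.poly_mult p q))) ?x"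
    unfolding lam_eval_def pm by (intro A.S.eval_normalize[symmetric] map_closed lam_closed) simp
  also have "A.S.normalize (?m (A.poly_mult p q)) = A.S.poly_mult (?m p) (?m q)"
    using assms by (intro \<iota>.poly_mult_hom') simp_all
  also have "A.S.eval \<dots> ?x = A.S.eval (?m p) ?x \<otimes>\<^bsub>A\<^esub> A.S.eval (?m q) ?x"
  proof (rule A.S.eval_poly_mult_commuting[OF map_closed map_closed lam_closed])
    fix u assume "u \<in> set (?m q)"
    then obtain c where "c \<in> k" "u = monomial K c \<one>\<^bsub>H\<^esub>" using assms by auto
    then show "u \<otimes>\<^bsub>A\<^esub> ?x = ?x \<otimes>\<^bsub>A\<^esub> u"
      using lam by (simp add: A.S_monomial_mult \<sigma>_one Units_closed)
  qed (use assms in auto)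
  finally show ?thesis by (simp add: lam_eval_def)
qed

lemma lam_eval_add:
  assumes "set p \<subseteq> k" "set q \<subseteq> k"
  shows "lam_eval (poly_add p q) = lam_eval p \<oplus>\<^bsub>A\<^esub> lam_eval q"
proof -
  let ?x = "monomial K \<one> (lam, \<one>\<^bsub>G\<^esub>)" and ?m = "map (\<lambda>c. monomial K c \<one>\<^bsub>H\<^esub>)"
  have pa: "poly_add p q = A.poly_add p q"
    using poly_add_consistent[OF subfieldE(1)[OF k]] by metis
  have "set (A.poly_add p q) \<subseteq> carrier K"
    using assms by (intro A.poly_add_in_carrier) simp_all
  then have "lam_eval (poly_add p q) = A.S.eval (A.S.normalize (?m (A.poly_add p q))) ?x"
    unfolding lam_eval_def pa by (intro A.S.eval_normalize[symmetric] map_closed lam_closed) simp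
  also have "A.S.normalize (?m (A.poly_add p q)) = A.S.poly_add (?m p) (?m q)"
    using assms by (intro \<iota>.poly_add_hom') simp_all
  also have "A.S.eval \<dots> ?x = A.S.eval (?m p) ?x \<oplus>\<^bsub>A\<^esub> A.S.eval (?m q) ?x"
    by (intro A.S.eval_poly_add map_closed lam_closed assms)
  finally show ?thesis by (simp only: lam_eval_def)
qed

lemma lam_power: "monomial K \<one> (lam, \<one>\<^bsub>G\<^esub>) [^]\<^bsub>A\<^esub> (i::nat) = monomial K \<one> (lam [^] i, \<one>\<^bsub>G\<^esub>)"
proof (induction i)
  case 0
  then show ?case by (simp add: A.S_one)
next
  case (Suc i)
  have "lam [^] i \<in> Units R" using lam by (rule Units_pow_closed)
  then show ?case
    using Suc lam by (simp add: A.S_monomial_mult \<sigma>_one Units_closed)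
qed

lemma lam_eval_monom:
  assumes "c \<in> k"
  shows "lam_eval (monom c i) = monomial K c (lam [^] i, \<one>\<^bsub>G\<^esub>)"
proof -
  have "map (\<lambda>c. monomial K c \<one>\<^bsub>H\<^esub>) (monom c i) = A.S.monom (monomial K c \<one>\<^bsub>H\<^esub>) i"
    using \<iota>.hom_zero by (simp add: monom_def A.S.monom_def)
  then have "lam_eval (monom c i) = monomial K c \<one>\<^bsub>H\<^esub> \<otimes>\<^bsub>A\<^esub> monomial K \<one> (lam [^] i, \<one>\<^bsub>G\<^esub>)"
    using assms lam_closed A.S.eval_monom[of "monomial K c \<one>\<^bsub>H\<^esub>"] by (simp add: lam_eval_def lam_power)
  moreover have "lam [^] i \<in> Units R" using lam by (rule Units_pow_closed)
  ultimately show ?thesis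
    using assms by (simp add: A.S_monomial_mult \<sigma>_one Units_closed)
qed

lemma unit_is_power:
  assumes "a \<in> Units R"
  obtains i :: nat where "a = lam [^] i"
proof -
  interpret U: group "units_of R" by (rule units_group)
  have "a \<in> {lam [^]\<^bsub>units_of R\<^esub> i | i. i \<in> (UNIV :: nat set)}"
    using U.generate_pow_on_finite_carrier[of lam] finite_Units lam assms generates
    by (simp add: units_of_carrier)
  then show thesis
    using that lam by (auto simp: units_of_pow)
qed

lemma polynomial_in_k: "q \<in> carrier (k[X]) \<Longrightarrow> set q \<subseteq> k"
  by (simp add: univ_poly_carrier[symmetric] polynomial_incl)

text \<open>
  Every unit is a power of \<^term>\<open>lam\<close>, so the part of an element lying over one \<open>g\<close> is a
  polynomial in \<open>(lam, 1)\<close> times \<open>(1, g)\<close>. The induction adds one monomial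
  \<open>c X\<^sup>i\<close> per unit \<open>lam\<^sup>i\<close>; a zero coefficient is skipped since polynomials are lists with
  nonzero head.
\<close>
lemma fibre_eq_lam_eval:
  assumes f: "f \<in> carrier A" and g: "g \<in> carrier G" and T: "T \<subseteq> Units R"
  shows "\<exists>q\<in>carrier (k[X]). lam_eval q \<otimes>\<^bsub>A\<^esub> monomial K \<one> (\<one>, g) = (\<lambda>z. if z \<in> T \<times> {g} then f z else \<zero>)"
proof -
  let ?d = "monomial K \<one> (\<one>, g)"
  have d: "?d \<in> carrier A" using g by simp
  have "finite T" using T finite_Units finite_subset by auto
  then show ?thesis
    using T
  proof (induction T)
    case empty
    have "[] \<in> carrier (k[X])" by (simp add: univ_poly_carrier[symmetric] zero_is_polynomial)
    moreover have "lam_eval [] \<otimes>\<^bsub>A\<^esub> ?d = \<zero>\<^bsub>A\<^esub>" using d by (simp add: lam_eval_def del: A.S_zero)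
    ultimately show ?case by auto
  next
    case (insert a T)
    then obtain q where q: "q \<in> carrier (k[X])"
      and Eq: "lam_eval q \<otimes>\<^bsub>A\<^esub> ?d = (\<lambda>z. if z \<in> T \<times> {g} then f z else \<zero>)" by auto
    show ?case
    proof (cases "f (a, g) = \<zero>")
      case True
      then have "lam_eval q \<otimes>\<^bsub>A\<^esub> ?d = (\<lambda>z. if z \<in> insert a T \<times> {g} then f z else \<zero>)"
        unfolding Eq by auto
      then show ?thesis using q by blast
    next
      case False
      obtain i :: nat where i: "a = lam [^] i" using insert.prems unit_is_power by blast
      let ?m = "monom (f (a, g)) i"
      have fk: "f (a, g) \<in> k" using f by (rule A_carrierD)
      have m: "polynomial k ?m"
        using fk False by (intro monom_is_polynomial subfieldE(1)[OF k]) simp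
      have sets: "set ?m \<subseteq> k" "set q \<subseteq> k"
        using m polynomial_incl q polynomial_in_k by auto
      have carr: "poly_add ?m q \<in> carrier (k[X])"
        using poly_add_is_polynomial[OF subfieldE(1)[OF k] sets] by (simp add: univ_poly_carrier)
      have "lam_eval (poly_add ?m q) \<otimes>\<^bsub>A\<^esub> ?d = lam_eval ?m \<otimes>\<^bsub>A\<^esub> ?d \<oplus>\<^bsub>A\<^esub> lam_eval q \<otimes>\<^bsub>A\<^esub> ?d"
        unfolding lam_eval_add[OF sets] by (intro A.S_distrib lam_eval_closed sets d)
      also have "lam_eval ?m \<otimes>\<^bsub>A\<^esub> ?d = monomial K (f (a, g)) (a, g)"
        using insert.prems fk g by (simp add: lam_eval_monom i[symmetric] A.S_monomial_mult \<sigma>_one Units_closed)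
      also have "monomial K (f (a, g)) (a, g) \<oplus>\<^bsub>A\<^esub> lam_eval q \<otimes>\<^bsub>A\<^esub> ?d
          = (\<lambda>z. if z \<in> insert a T \<times> {g} then f z else \<zero>)"
        unfolding Eq using insert.hyps fk A_carrierD(2)[OF f] by (auto simp: monomial_def)
      finally show ?thesis using carr by (rule bexI)
    qed
  qed
qed

text \<open>
  If \<open>\<psi> f = 0\<close>, the polynomial describing the part of \<open>f\<close> over each \<open>g\<close> vanishes at
  \<^term>\<open>lam\<close>, so it is a multiple of the minimal polynomial and the part lies in every ideal
  that contains the value of the minimal polynomial. Finitely many parts add up to \<open>f\<close>.
\<close>
lemma kernel_subset_ideal:
  assumes f: "f \<in> carrier A" "\<psi> f = \<zero>\<^bsub>S\<^esub>"
    and I: "ideal I A" "lam_eval (Irr k lam) \<in> I"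
  shows "f \<in> I"
proof -
  interpret I: ideal I A by (rule I(1))
  have lamc: "lam \<in> carrier R" using lam by auto
  note alg = algebraic_if_finite_carrier[OF k finite lamc]
  note Irr = IrrE[OF k lamc alg]
  have fibre: "(\<lambda>z. if z \<in> Units R \<times> {g} then f z else \<zero>) \<in> I" if g: "g \<in> carrier G" for g
  proof -
    let ?d = "monomial K \<one> (\<one>, g)"
    let ?f = "\<lambda>z. if z \<in> Units R \<times> {g} then f z else \<zero>"
    have d: "?d \<in> carrier A" using g by simp
    obtain q where q: "q \<in> carrier (k[X])" and Eq: "lam_eval q \<otimes>\<^bsub>A\<^esub> ?d = ?f"
      using fibre_eq_lam_eval[OF f(1) g order_refl] by blast
    note qk = polynomial_in_k[OF q]
    have ev: "eval q lam \<in> carrier R"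
      using qk lamc by (intro eval_in_carrier) auto
    have ev_psi: "monomial R (eval q lam) g = \<psi> (lam_eval q \<otimes>\<^bsub>A\<^esub> ?d)"
      using d qk g ev by (simp add: \<psi>_mult lam_eval_closed \<psi>_lam_eval \<psi>_monomial S_monomial_mult \<sigma>_one)
    have "eval q lam = monomial R (eval q lam) g g"
      by (simp add: monomial_def)
    also have "\<dots> = \<psi> ?f g"
      unfolding ev_psi Eq ..
    also have "\<dots> = \<psi> f g"
      unfolding \<psi>_def using A_carrierD(2)[OF f(1)] by (intro finsum_cong') auto
    finally have "eval q lam = \<zero>" using f(2) by simp
    then have "Irr k lam divides\<^bsub>k[X]\<^esub> q"
      using Irr_minimal[OF k lamc alg q] pdivides_iff_shell[OF k Irr(1) q] by simp
    then obtain s where s: "s \<in> carrier (k[X])" "q = poly_mult (Irr k lam) s"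
      by (auto simp: factor_def univ_poly_mult)
    then have "lam_eval q = lam_eval (Irr k lam) \<otimes>\<^bsub>A\<^esub> lam_eval s"
      using lam_eval_mult polynomial_in_k Irr(1) by simp
    then have "lam_eval q \<in> I"
      using I(2) lam_eval_closed[OF polynomial_in_k[OF s(1)]] I.I_r_closed by simp
    then show ?thesis
      using I.I_r_closed[OF _ d] unfolding Eq[symmetric] by blast
  qed
  have fibres: "(\<lambda>z. if snd z \<in> T then f z else \<zero>) \<in> I" if "finite T" "T \<subseteq> carrier G" for T
    using that
  proof (induction T)
    case empty
    then show ?case using I.zero_closed by simp
  next
    case (insert g T)
    have "f (a, h) = \<zero>" if "a \<notin> Units R" for a h
      using A.S_carrierD(4)[OF f(1), of "(a, h)"] that by simp
    then have "(\<lambda>z. if snd z \<in> insert g T then f z else \<zero>)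
      = (\<lambda>z. if z \<in> Units R \<times> {g} then f z else \<zero>) \<oplus>\<^bsub>A\<^esub> (\<lambda>z. if snd z \<in> T then f z else \<zero>)"
      using insert.hyps A_carrierD(2)[OF f(1)] by (auto simp: fun_eq_iff)
    moreover have "(\<lambda>z. if z \<in> Units R \<times> {g} then f z else \<zero>) \<in> I"
      using fibre insert.prems by simp
    ultimately show ?case
      using insert I.a_closed by (simp del: A.S_add)
  qed
  have "finite (snd ` supp K f)" "snd ` supp K f \<subseteq> carrier G"
    using A.S_carrierD(2,3)[OF f(1)] by (auto simp: hat_group_def)
  then have "(\<lambda>z. if snd z \<in> snd ` supp K f then f z else \<zero>) \<in> I"
    by (rule fibres)
  also have "(\<lambda>z. if snd z \<in> snd ` supp K f then f z else \<zero>) = f"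
    by (auto simp: supp_def image_iff)
  finally show ?thesis .
qed

lemma kernel_\<psi>: "a_kernel A S \<psi> = Idl\<^bsub>A\<^esub> {lam_eval (Irr k lam)}"
proof
  have lamc: "lam \<in> carrier R" using lam by auto
  note Irr = IrrE[OF k lamc algebraic_if_finite_carrier[OF k finite lamc]]
  have closed: "lam_eval (Irr k lam) \<in> carrier A" by (intro lam_eval_closed polynomial_in_k Irr(1))
  have "\<psi> (lam_eval (Irr k lam)) = \<zero>\<^bsub>S\<^esub>"
    using \<psi>_lam_eval[OF polynomial_in_k[OF Irr(1)]] Irr(4) by (simp add: monomial_def fun_eq_iff)
  then have "{lam_eval (Irr k lam)} \<subseteq> a_kernel A S \<psi>"
    using closed unfolding a_kernel_def' by blast
  then show "Idl\<^bsub>A\<^esub> {lam_eval (Irr k lam)} \<subseteq> a_kernel A S \<psi>"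
    by (rule A.S.genideal_minimal[OF \<psi>.kernel_is_ideal])
  have "ideal (Idl\<^bsub>A\<^esub> {lam_eval (Irr k lam)}) A" "lam_eval (Irr k lam) \<in> Idl\<^bsub>A\<^esub> {lam_eval (Irr k lam)}"
    using closed by (simp_all only: A.S.genideal_ideal A.S.genideal_self' empty_subsetI insert_subset)
  then show "a_kernel A S \<psi> \<subseteq> Idl\<^bsub>A\<^esub> {lam_eval (Irr k lam)}"
    using kernel_subset_ideal unfolding a_kernel_def' by blast
qed

end

section \<open>The action by field automorphisms\<close>

text \<open>
  The fixed points form an additive subgroup of \<^term>\<open>k\<close>, a group of prime order. It contains
  both zero and one, so Lagrange's theorem leaves only the whole of \<^term>\<open>k\<close>.
\<close>
lemma (in field) ring_hom_fixes_prime_subfield: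
  assumes k: "subfield k R" and p: "Factorial_Ring.prime (card k)"
    and s: "s \<in> ring_hom R R" and c: "c \<in> k"
  shows "s c = c"
proof -
  interpret s: ring_hom_ring R R s
    by (rule ring_hom_ringI2[OF ring_axioms ring_axioms s])
  interpret K: ring "R\<lparr>carrier := k\<rparr>"
    by (rule subring_is_ring[OF subfieldE(1)[OF k]])
  note kE = subringE[OF subfieldE(1)[OF k]]
  have sub: "a \<in> carrier R" if "a \<in> k" for a using that kE(1) by auto
  let ?F = "{c \<in> k. s c = c}"
  have fin: "finite k" using p by (metis card.infinite not_prime_0)
  have neg: "inv\<^bsub>add_monoid (R\<lparr>carrier := k\<rparr>)\<^esub> a = \<ominus> a" if "a \<in> k" for a
  proof -
    have "\<ominus>\<^bsub>R\<lparr>carrier := k\<rparr>\<^esub> a = \<ominus> a"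
      using K.add.inv_equality[of "\<ominus> a" a] that sub kE(5) by (simp add: a_inv_def[symmetric] l_neg)
    then show ?thesis by (simp only: a_inv_def[of "R\<lparr>carrier := k\<rparr>"])
  qed
  have sg: "subgroup ?F (add_monoid (R\<lparr>carrier := k\<rparr>))"
  proof (rule subgroup.intro)
    fix a assume "a \<in> ?F"
    then have "inv\<^bsub>add_monoid (R\<lparr>carrier := k\<rparr>)\<^esub> a = \<ominus> a" "\<ominus> a \<in> ?F"
      using kE(5) sub neg[of a] by simp_all
    then show "inv\<^bsub>add_monoid (R\<lparr>carrier := k\<rparr>)\<^esub> a \<in> ?F" by (simp only:)
  qed (use kE sub in auto)
  have order: "order (add_monoid (R\<lparr>carrier := k\<rparr>)) = card k"
    by (simp add: order_def)
  have "card ?F dvd card (rcosets\<^bsub>add_monoid (R\<lparr>carrier := k\<rparr>)\<^esub> ?F) * card ?F"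
    by (rule dvd_triv_right)
  then have dvd: "card ?F dvd card k"
    by (simp only: K.add.lagrange[OF sg] order)
  have not_one: "card ?F \<noteq> 1"
  proof
    assume "card ?F = 1"
    then obtain b where b: "?F = {b}" by (rule card_1_singletonE)
    have "\<zero> \<in> ?F" "\<one> \<in> ?F" using kE(2,3) by simp_all
    then show False unfolding b using one_not_zero by simp
  qed
  have "card ?F = card k"
    using p dvd not_one unfolding prime_nat_iff by blast
  then have "?F = k"
    using fin by (intro card_subset_eq) auto
  then show ?thesis using c by blast
qed

text \<open>
  By multiplicativity \<open>\<sigma> 1\<close> is an idempotent bijection, hence the identity.
\<close>
lemma hom_ring_AutoGroupD:
  assumes "group G" "ring R" and \<sigma>: "\<sigma> \<in> hom G (ring_AutoGroup R)"
  shows "g \<in> carrier G \<Longrightarrow> \<sigma> g \<in> ring_hom R R"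
    and "\<lbrakk>g \<in> carrier G; h \<in> carrier G; a \<in> carrier R\<rbrakk> \<Longrightarrow> \<sigma> (g \<otimes>\<^bsub>G\<^esub> h) a = \<sigma> g (\<sigma> h a)"
    and "a \<in> carrier R \<Longrightarrow> \<sigma> \<one>\<^bsub>G\<^esub> a = a"
proof -
  interpret G: group G by fact
  have mem: "\<sigma> g \<in> ring_iso R R" "\<sigma> g \<in> Bij (carrier R)" if "g \<in> carrier G" for g
    using hom_in_carrier[OF \<sigma> that] by (auto simp: ring_AutoGroup_def)
  show "g \<in> carrier G \<Longrightarrow> \<sigma> g \<in> ring_hom R R" for g
    using mem(1) by (simp add: ring_iso_def)
  show mult: "\<sigma> (g \<otimes>\<^bsub>G\<^esub> h) a = \<sigma> g (\<sigma> h a)"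
    if "g \<in> carrier G" "h \<in> carrier G" "a \<in> carrier R" for g h a
    using hom_mult[OF \<sigma> that(1,2)] mem(2) that
    by (simp add: ring_AutoGroup_def BijGroup_def compose_eq)
  show "\<sigma> \<one>\<^bsub>G\<^esub> a = a" if a: "a \<in> carrier R"
  proof -
    have b: "bij_betw (\<sigma> \<one>\<^bsub>G\<^esub>) (carrier R) (carrier R)"
      using mem(2)[of "\<one>\<^bsub>G\<^esub>"] by (simp add: Bij_def)
    have "\<sigma> \<one>\<^bsub>G\<^esub> a \<in> carrier R"
      using b a by (auto dest: bij_betwE)
    moreover have "\<sigma> \<one>\<^bsub>G\<^esub> (\<sigma> \<one>\<^bsub>G\<^esub> a) = \<sigma> \<one>\<^bsub>G\<^esub> a"
      using mult[of "\<one>\<^bsub>G\<^esub>" "\<one>\<^bsub>G\<^esub>" a] a by simp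
    ultimately show ?thesis
      using b a by (auto simp: bij_betw_def inj_on_def)
  qed
qed

section \<open>The presentation of the twisted skew group ring\<close>

theorem proposition5:
  fixes G :: "('g, 'n) monoid_scheme" and F :: "('a, 'm) ring_scheme"
    and k :: "'a set" and p n :: nat
    and \<sigma> :: "'g \<Rightarrow> 'a \<Rightarrow> 'a" and \<alpha> :: "'g \<Rightarrow> 'g \<Rightarrow> 'a" and lam :: 'a
  assumes "group G"
    and "Factorial_Ring.prime p"
    and "field F" and "card (carrier F) = p ^ n"
    and "subfield k F" and "card k = p"
    and "\<sigma> \<in> hom G (ring_AutoGroup F)"
    and "normalized_2cocycle F G \<sigma> \<alpha>"
    and "lam \<in> Units F" and "generate (units_of F) {lam} = Units F"
  shows "let K = F\<lparr>carrier := k\<rparr>;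
             A = group_algebra K (hat_group F G \<sigma> \<alpha>);
             B = twisted_skew_group_ring F G \<sigma> \<alpha>;
             P = ring.Irr F k lam
         in \<exists>\<psi> \<in> algebra_epi K A B.
              a_kernel A B \<psi> = Idl\<^bsub>A\<^esub> {algebra_eval K A P (monomial K \<one>\<^bsub>K\<^esub> (lam, \<one>\<^bsub>G\<^esub>))}"
proof -
  interpret F: field F by fact
  interpret finite_field_twisted_skew F G \<sigma> \<alpha> k lam
  proof (intro finite_field_twisted_skew.intro twisted_skew.intro twisted_skew_axioms.intro
      finite_field_twisted_skew_axioms.intro)
    have "0 < card (carrier F)" using assms(2,4) by (simp add: prime_gt_0_nat)
    then show "finite (carrier F)" by (rule card_ge_0_finite)
    show "\<sigma> g c = c" if "g \<in> carrier G" "c \<in> k" for g c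
      using F.ring_hom_fixes_prime_subfield assms(2,5,6)
        hom_ring_AutoGroupD(1)[OF assms(1) F.ring_axioms assms(7)] that by metis
  qed (use assms hom_ring_AutoGroupD[OF assms(1) F.ring_axioms assms(7)] F.is_cring in auto)
  have epi: "\<psi> \<in> algebra_epi K A S"
    using \<psi>.homh \<psi>_surj \<psi>_smult by (simp add: algebra_epi_def algebra_hom_def)
  have "set (F.Irr k lam) \<subseteq> k"
    using F.IrrE(1)[OF k _ F.algebraic_if_finite_carrier[OF k finite]] lam
    by (intro polynomial_in_k) auto
  then have "algebra_eval K A (F.Irr k lam) (monomial K \<one>\<^bsub>K\<^esub> (lam, \<one>\<^bsub>G\<^esub>)) = lam_eval (F.Irr k lam)"
    using algebra_eval_eq_lam_eval by simp
  with kernel_\<psi> have ker: "a_kernel A S \<psi>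
      = Idl\<^bsub>A\<^esub> {algebra_eval K A (F.Irr k lam) (monomial K \<one>\<^bsub>K\<^esub> (lam, \<one>\<^bsub>G\<^esub>))}"
    by (simp only:)
  show ?thesis
    unfolding Let_def by (rule bexI[where x = \<psi>]) (fact ker, fact epi)
qed

end
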